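(* Let $m\ge 2$ be an integer. The set $\bigcup_{x\in(0,1)\cap\mathbb Q}\Lambda(x)$ has zero Lebesgue measure, and the set $$(0,1/m]\setminus\bigcup_{x\in(0,1)\cap\mathbb Q}\Lambda(x)=\left\{\lambda\in(0,1/m]: K_\lambda\subset\big((0,1)\cap\mathbb Q\big)^c\right\}$$ has full Lebesgue measure $1/m$. In other words, for Lebesgue almost every $\lambda\in(0,1/m]$ the set $K_\lambda\setminus\{0\}$ contains only irrational numbers.
   Context: For $\lambda\in(0,1/m]$, $K_\lambda=\left\{\sum_{i=1}^\infty d_i\lambda^i: d_i\in\{0,1,\ldots,m-1\},\ i\ge 1\right\}\subset\mathbb R$, and for $x\in(0,1)$, $\Lambda(x)=\{\lambda\in(0,1/m]: x\in K_\lambda\}$. The superscript $c$ denotes complement in $\mathbb R$. *)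

theory Defs
  imports "HOL-Analysis.Analysis"
begin

definition K_set :: "nat \<Rightarrow> real \<Rightarrow> real set" where
  "K_set m l = {\<Sum>i. real (d (Suc i)) * l ^ Suc i | d :: nat \<Rightarrow> nat. \<forall>i\<ge>1. d i \<in> {0..m - 1}}"

definition Lambda_set :: "nat \<Rightarrow> real \<Rightarrow> real set" where
  "Lambda_set m x = {l \<in> {0<..1 / real m}. x \<in> K_set m l}"

end

theory Submission
  imports Defs
begin

text \<open>
  It suffices to show that \<open>\<Lambda>(x)\<close> is null for each single \<open>x > 0\<close>, since the union runs over
  countably many \<open>x\<close>. Fix \<open>b < 1/m\<close> and consider the \<open>\<lambda> \<le> b\<close> in \<open>\<Lambda>(x)\<close>. Cut an
  expansion of \<open>x\<close> in powers of \<open>\<lambda>\<close> after \<open>n\<close> digits: the remaining tail is at most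
  \<open>\<lambda>\<^sup>n \<le> b\<^sup>n\<close>, so the polynomial whose coefficients are the first \<open>n\<close> digits takes at
  \<open>\<lambda>\<close> a value within \<open>b\<^sup>n\<close> of \<open>x\<close> (\<open>K_set_prefix\<close>). This polynomial has nonnegative
  coefficients and no constant term, so its slope is at least its value, which is about \<open>x\<close>
  (\<open>digit_poly_growth\<close>). Hence all \<open>\<lambda>\<close> that share a given prefix lie in an interval of length
  \<open>O(b\<^sup>n / x)\<close>. There are \<open>m\<^sup>n\<close> prefixes, so the whole set is covered by intervals of total
  length \<open>O((m b)\<^sup>n)\<close>, which tends to \<open>0\<close> because \<open>m b < 1\<close> (\<open>negligible_Lambda_set_le\<close>).
  Letting \<open>b\<close> increase to \<open>1/m\<close> through the rationals leaves out only the point \<open>1/m\<close>.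

  For \<open>\<lambda> < 1/m\<close> every element of \<open>K_\<lambda>\<close> is smaller than \<open>1\<close>, so a nonzero rational element
  would lie in \<open>(0,1)\<close>; this gives the statement about \<open>K_\<lambda> - {0}\<close> outside the null set
  enlarged by the point \<open>1/m\<close>, where \<open>1\<close> does belong to \<open>K_\<lambda>\<close>.
\<close>

section \<open>Digit expansions and their prefixes\<close>

definition digit_poly :: "nat \<Rightarrow> (nat \<Rightarrow> nat) \<Rightarrow> real \<Rightarrow> real" where
  "digit_poly n w l = (\<Sum>i<n. real (w i) * l ^ Suc i)"

lemma digit_series_bounds:
  fixes w :: "nat \<Rightarrow> nat"
  assumes "\<And>i. w i \<le> m - 1" "m \<ge> 1" "0 < l" "l < 1"
  shows "summable (\<lambda>i. real (w i) * l ^ Suc i)"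
    and "0 \<le> (\<Sum>i. real (w i) * l ^ Suc i)"
    and "(\<Sum>i. real (w i) * l ^ Suc i) \<le> (real m - 1) * l / (1 - l)"
proof -
  have le: "real (w i) * l ^ Suc i \<le> (real m - 1) * l * l ^ i" for i
  proof -
    have "real (w i) \<le> real m - 1"
      using assms(1)[of i] assms(2) by linarith
    then have "real (w i) * l ^ Suc i \<le> (real m - 1) * l ^ Suc i"
      using assms(3) by (intro mult_right_mono) auto
    then show ?thesis by (simp add: mult_ac)
  qed
  have geo: "(\<lambda>i. (real m - 1) * l * l ^ i) sums ((real m - 1) * l * (1 / (1 - l)))"
    using assms by (intro sums_mult geometric_sums) auto
  show s: "summable (\<lambda>i. real (w i) * l ^ Suc i)"
  proof (rule summable_comparison_test'[OF sums_summable[OF geo], of 0])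
    fix i
    show "norm (real (w i) * l ^ Suc i) \<le> (real m - 1) * l * l ^ i"
      using le[of i] assms(3) by simp
  qed
  show "0 \<le> (\<Sum>i. real (w i) * l ^ Suc i)"
    using s assms(3) by (intro suminf_nonneg) auto
  show "(\<Sum>i. real (w i) * l ^ Suc i) \<le> (real m - 1) * l / (1 - l)"
    using suminf_le[OF le s sums_summable[OF geo]] sums_unique[OF geo] by simp
qed

lemma K_setE:
  assumes "y \<in> K_set m l"
  obtains w :: "nat \<Rightarrow> nat" where "\<And>i. w i \<le> m - 1" "y = (\<Sum>i. real (w i) * l ^ Suc i)"
proof -
  obtain d :: "nat \<Rightarrow> nat" where d: "\<forall>i\<ge>1. d i \<in> {0..m - 1}"
    and y: "y = (\<Sum>i. real (d (Suc i)) * l ^ Suc i)"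
    using assms unfolding K_set_def by blast
  show thesis
    by (rule that[of "\<lambda>i. d (Suc i)"]) (use d y in auto)
qed

text \<open>
  Taking all digits equal to \<open>m - 1\<close> gives the largest element \<open>(m - 1) \<lambda> / (1 - \<lambda>)\<close>, which is
  smaller than \<open>1\<close> exactly when \<open>m \<lambda> < 1\<close>.
\<close>
lemma K_set_less_one:
  assumes "m \<ge> 2" "0 < l" "l < 1 / real m" "y \<in> K_set m l"
  shows "0 \<le> y" "y < 1"
proof -
  obtain w where w: "\<And>i. w i \<le> m - 1" and y: "y = (\<Sum>i. real (w i) * l ^ Suc i)"
    using K_setE[OF assms(4)] by blast
  have ml: "real m * l < 1"
    using assms(1,3) by (simp add: field_simps)
  moreover have "1 * l \<le> real m * l"
    using assms(1,2) by (intro mult_right_mono) auto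
  ultimately have l1: "l < 1" by simp
  have m1: "m \<ge> 1" using assms(1) by simp
  show "0 \<le> y"
    using digit_series_bounds(2)[OF w m1 assms(2) l1] y by simp
  have "y \<le> (real m - 1) * l / (1 - l)"
    using digit_series_bounds(3)[OF w m1 assms(2) l1] y by simp
  also have "\<dots> < 1"
    using ml l1 by (simp add: divide_simps algebra_simps)
  finally show "y < 1" .
qed

text \<open>
  The tail of the expansion is \<open>\<lambda>\<^sup>n\<close> times a point of \<open>K_\<lambda>\<close>, and \<open>K_\<lambda>\<close> lies in the unit
  interval. The prefixes are taken as extensional functions so that there are exactly \<open>m\<^sup>n\<close> of
  them.
\<close>
lemma K_set_prefix:
  assumes "m \<ge> 2" "0 < l" "l < 1 / real m" "x \<in> K_set m l"
  obtains w where "w \<in> {..<n} \<rightarrow>\<^sub>E {..m - 1}"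
    "digit_poly n w l \<le> x" "x \<le> digit_poly n w l + l ^ n"
proof -
  obtain d where d: "\<And>i. d i \<le> m - 1" and x: "x = (\<Sum>i. real (d i) * l ^ Suc i)"
    using K_setE[OF assms(4)] by blast
  have "1 / real m \<le> 1 / 1"
    using assms(1) by (intro divide_left_mono) auto
  then have l1: "l < 1" using assms(3) by simp
  have m1: "m \<ge> 1" using assms(1) by simp
  define t where "t = (\<Sum>i. real (d (i + n)) * l ^ Suc i)"
  have "t \<in> K_set m l"
    unfolding K_set_def t_def
    by (rule CollectI, rule exI[of _ "\<lambda>i. d (i - 1 + n)"]) (use d in auto)
  then have t: "0 \<le> t" "t < 1"
    using K_set_less_one[OF assms(1-3)] by blast+
  have sum: "summable (\<lambda>i. real (d i) * l ^ Suc i)"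
    by (rule digit_series_bounds(1)[OF d m1 assms(2) l1])
  have sumt: "summable (\<lambda>i. real (d (i + n)) * l ^ Suc i)"
    by (rule digit_series_bounds(1)[OF d m1 assms(2) l1])
  have "x = (\<Sum>i. real (d (i + n)) * l ^ Suc (i + n)) + digit_poly n d l"
    unfolding x digit_poly_def by (rule suminf_split_initial_segment[OF sum])
  also have "(\<Sum>i. real (d (i + n)) * l ^ Suc (i + n)) = l ^ n * t"
    unfolding t_def suminf_mult[OF sumt, symmetric] by (simp add: power_add mult_ac)
  finally have xt: "x = l ^ n * t + digit_poly n d l" .
  have "digit_poly n (restrict d {..<n}) l = digit_poly n d l"
    unfolding digit_poly_def by (intro sum.cong) auto
  moreover have "0 \<le> l ^ n * t"
    using t assms(2) by simp
  moreover have "l ^ n * t \<le> l ^ n"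
    using t assms(2) by (simp add: mult_left_le)
  ultimately show thesis
    using that[of "restrict d {..<n}"] d xt by auto
qed

section \<open>The parameters for which a given point occurs\<close>

text \<open>
  Termwise, for \<open>k \<ge> 1\<close> and \<open>0 \<le> a \<le> c\<close>, the difference \<open>c\<^sup>k - a\<^sup>k\<close> is at least
  \<open>(c - a) a\<^sup>k\<^sup>-\<^sup>1\<close>, which for \<open>a \<le> 1\<close> is at least \<open>(c - a) a\<^sup>k\<close>.
\<close>
lemma digit_poly_growth:
  assumes "0 \<le> a" "a \<le> c" "a \<le> 1"
  shows "(c - a) * digit_poly n w a \<le> digit_poly n w c - digit_poly n w a"
proof -
  have "(c - a) * (real (w i) * a ^ Suc i) \<le> real (w i) * c ^ Suc i - real (w i) * a ^ Suc i" for i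
  proof -
    have "(c - a) * a ^ Suc i \<le> (c - a) * a ^ i"
      using assms by (intro mult_left_mono) (auto intro: mult_left_le_one_le)
    also have "\<dots> = c * a ^ i - a ^ Suc i"
      by (simp add: algebra_simps)
    also have "\<dots> \<le> c ^ Suc i - a ^ Suc i"
      using assms by (simp add: mult_left_mono power_mono)
    finally have "real (w i) * ((c - a) * a ^ Suc i) \<le> real (w i) * (c ^ Suc i - a ^ Suc i)"
      by (intro mult_left_mono) auto
    then show ?thesis by (simp add: algebra_simps)
  qed
  then show ?thesis
    unfolding digit_poly_def sum_distrib_left sum_subtractf[symmetric] by (intro sum_mono)
qed

text \<open>
  Two parameters sharing a prefix are close because the prefix polynomial grows with slope at
  least \<open>x / 2\<close> but varies by at most \<open>e\<close> between them.
\<close>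
lemma digit_poly_parameters_close:
  assumes "0 < a" "a \<le> c" "a \<le> 1" "0 < x" "e \<le> x / 2"
    and "digit_poly n w c \<le> x" "x \<le> digit_poly n w a + e"
  shows "c - a \<le> 2 * e / x"
proof -
  have "(c - a) * (x / 2) \<le> (c - a) * digit_poly n w a"
    using assms by (intro mult_left_mono) auto
  also have "\<dots> \<le> digit_poly n w c - digit_poly n w a"
    using assms by (intro digit_poly_growth) auto
  also have "\<dots> \<le> e"
    using assms by simp
  finally show ?thesis
    using assms by (simp add: field_simps)
qed

lemma negligible_Lambda_set_le:
  assumes m: "m \<ge> 2" and x: "0 < x" and b: "0 < b" "b < 1 / real m"
  shows "negligible (Lambda_set m x \<inter> {..b})"
  unfolding negligible_outer_le
proof (intro allI impI)
  fix e :: real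
  assume e: "e > 0"
  have b1: "real m * b < 1"
    using b m by (simp add: field_simps)
  moreover have "1 * b \<le> real m * b"
    using m b by (intro mult_right_mono) auto
  ultimately have blt1: "b < 1" by simp
  have "(\<lambda>n. b ^ n) \<longlonglongrightarrow> 0"
    using b blt1 by (intro LIMSEQ_realpow_zero) auto
  then have ev1: "eventually (\<lambda>n. b ^ n < x / 2) sequentially"
    using x by (intro order_tendstoD(2)) auto
  have "(\<lambda>n. (4 / x) * (real m * b) ^ n) \<longlonglongrightarrow> (4 / x) * 0"
    using b b1 by (intro tendsto_mult_left LIMSEQ_realpow_zero) auto
  then have ev2: "eventually (\<lambda>n. (4 / x) * (real m * b) ^ n < e) sequentially"
    using e by (intro order_tendstoD(2)) auto
  obtain n where n: "b ^ n < x / 2" "(4 / x) * (real m * b) ^ n < e"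
    using eventually_happens[OF eventually_conj[OF ev1 ev2]] by auto
  define W where "W = ({..<n} \<rightarrow>\<^sub>E {..m - 1})"
  define S where "S w = {l. 0 < l \<and> l \<le> b \<and> digit_poly n w l \<le> x \<and> x \<le> digit_poly n w l + b ^ n}"
    for w
  define r where "r = 2 * b ^ n / x"
  define I where "I w = (let p = (SOME l. l \<in> S w) in {p - r..p + r})" for w
  define T where "T = (\<Union>w\<in>W. I w)"
  have r0: "r \<ge> 0" unfolding r_def using b x by simp
  have S_I: "S w \<subseteq> I w" for w
  proof
    fix l assume l: "l \<in> S w"
    define p where "p = (SOME l. l \<in> S w)"
    have p: "p \<in> S w" unfolding p_def using l by (rule someI)
    have close: "c - a \<le> r" if "a \<in> S w" "c \<in> S w" "a \<le> c" for a c
      unfolding r_def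
      by (rule digit_poly_parameters_close[of a c x "b ^ n" n w])
        (use that n(1) x blt1 in \<open>auto simp: S_def\<close>)
    have "\<bar>l - p\<bar> \<le> r"
      using close[OF l p] close[OF p l] by linarith
    then show "l \<in> I w"
      unfolding I_def Let_def p_def[symmetric] by auto
  qed
  have "Lambda_set m x \<inter> {..b} \<subseteq> T"
  proof
    fix l assume "l \<in> Lambda_set m x \<inter> {..b}"
    then have l: "0 < l" "l \<le> b" "x \<in> K_set m l"
      unfolding Lambda_set_def by auto
    then have "l < 1 / real m" using b by simp
    then obtain w where w: "w \<in> W" "digit_poly n w l \<le> x" "x \<le> digit_poly n w l + l ^ n"
      using K_set_prefix[OF m l(1) _ l(3), of n] unfolding W_def by blast
    have "l ^ n \<le> b ^ n"
      using l by (intro power_mono) auto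
    then have "l \<in> S w"
      unfolding S_def using l w by auto
    then show "l \<in> T"
      unfolding T_def using S_I w(1) by blast
  qed
  moreover have finW: "finite W"
    unfolding W_def by (intro finite_PiE) auto
  have cardW: "card W = m ^ n"
    unfolding W_def using m by (simp add: card_PiE)
  have I_meas: "I w \<in> lmeasurable" "measure lebesgue (I w) = 2 * r" for w
    unfolding I_def Let_def using r0 by auto
  have "T \<in> lmeasurable"
    unfolding T_def using finW I_meas by (intro fmeasurable.finite_UN) auto
  moreover have "measure lebesgue T \<le> e"
  proof -
    have "measure lebesgue T \<le> (\<Sum>w\<in>W. measure lebesgue (I w))"
      unfolding T_def using finW I_meas by (intro measure_UNION_le) (auto simp: fmeasurableD)
    also have "\<dots> = (4 / x) * (real m * b) ^ n"
      by (simp add: I_meas cardW r_def power_mult_distrib)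
    finally show ?thesis using n(2) by simp
  qed
  ultimately show "\<exists>T. Lambda_set m x \<inter> {..b} \<subseteq> T \<and> T \<in> lmeasurable \<and> measure lebesgue T \<le> e"
    by blast
qed

lemma negligible_Lambda_set:
  assumes m: "m \<ge> 2" and x: "0 < x"
  shows "negligible (Lambda_set m x)"
proof -
  define B where "B = \<rat> \<inter> {0<..<1 / real m}"
  have "negligible (\<Union>b\<in>B. Lambda_set m x \<inter> {..b})"
  proof (rule negligible_countable_Union)
    show "countable ((\<lambda>b. Lambda_set m x \<inter> {..b}) ` B)"
      unfolding B_def by (intro countable_image countable_Int1 countable_rat)
  qed (auto simp: B_def intro!: negligible_Lambda_set_le m x)
  then have "negligible (insert (1 / real m) (\<Union>b\<in>B. Lambda_set m x \<inter> {..b}))"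
    by simp
  moreover have "Lambda_set m x \<subseteq> insert (1 / real m) (\<Union>b\<in>B. Lambda_set m x \<inter> {..b})"
  proof
    fix l assume l: "l \<in> Lambda_set m x"
    show "l \<in> insert (1 / real m) (\<Union>b\<in>B. Lambda_set m x \<inter> {..b})"
    proof (cases "l = 1 / real m")
      case False
      then have "0 < l" "l < 1 / real m"
        using l unfolding Lambda_set_def by auto
      then obtain b where "b \<in> \<rat>" "l < b" "b < 1 / real m"
        using Rats_dense_in_real by blast
      then have "b \<in> B" "l \<in> Lambda_set m x \<inter> {..b}"
        using l \<open>0 < l\<close> unfolding B_def by auto
      then show ?thesis by blast
    qed simp
  qed
  ultimately show ?thesis by (rule negligible_subset)
qed

theorem mainTheorem4:
  fixes m :: nat
  assumes "m \<ge> 2"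
  shows "(\<Union>x\<in>{0<..<1} \<inter> \<rat>. Lambda_set m x) \<in> null_sets lebesgue
    \<and> {0<..1 / real m} - (\<Union>x\<in>{0<..<1} \<inter> \<rat>. Lambda_set m x)
        = {l \<in> {0<..1 / real m}. K_set m l \<subseteq> - ({0<..<1} \<inter> \<rat>)}
    \<and> {0<..1 / real m} - (\<Union>x\<in>{0<..<1} \<inter> \<rat>. Lambda_set m x) \<in> sets lebesgue
    \<and> emeasure lebesgue ({0<..1 / real m} - (\<Union>x\<in>{0<..<1} \<inter> \<rat>. Lambda_set m x))
        = ennreal (1 / real m)
    \<and> (AE l in lebesgue. l \<in> {0<..1 / real m} \<longrightarrow> (\<forall>y\<in>K_set m l - {0}. y \<notin> \<rat>))"
proof -
  define N where "N = (\<Union>x\<in>{0<..<1} \<inter> \<rat>. Lambda_set m x)"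
  have N: "N \<in> null_sets lebesgue"
    unfolding N_def using negligible_Lambda_set[OF assms]
    by (intro null_sets_UN' countable_Int2 countable_rat) (auto simp: negligible_iff_null_sets)
  have eq: "{0<..1 / real m} - N = {l \<in> {0<..1 / real m}. K_set m l \<subseteq> - ({0<..<1} \<inter> \<rat>)}"
    unfolding N_def Lambda_set_def by auto
  have meas: "{0<..1 / real m} - N \<in> sets lebesgue"
    using N by (intro sets.Diff) auto
  have "emeasure lebesgue ({0<..1 / real m} - N) = emeasure lebesgue {0<..1 / real m}"
    using N by (intro emeasure_Diff_null_set) auto
  then have em: "emeasure lebesgue ({0<..1 / real m} - N) = ennreal (1 / real m)"
    by simp
  have "{1 / real m} \<in> null_sets lebesgue"
    by (simp flip: negligible_iff_null_sets)
  then have "N \<union> {1 / real m} \<in> null_sets lebesgue"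
    using N by (intro null_sets.Un)
  then have ae: "AE l in lebesgue. l \<in> {0<..1 / real m} \<longrightarrow> (\<forall>y\<in>K_set m l - {0}. y \<notin> \<rat>)"
  proof (rule AE_I')
    have "l = 1 / real m"
      if l: "l \<in> {0<..1 / real m}" "l \<notin> N" and y: "y \<in> K_set m l" "y \<in> \<rat>" "y \<noteq> 0" for l y
    proof (rule ccontr)
      assume "l \<noteq> 1 / real m"
      then have "0 \<le> y" "y < 1"
        using l(1) K_set_less_one[OF assms _ _ y(1)] by auto
      then have "y \<in> {0<..<1} \<inter> \<rat>" using y by auto
      then have "l \<in> N"
        unfolding N_def Lambda_set_def using l(1) y(1) by blast
      then show False using l(2) by simp
    qed
    then show "{l \<in> space lebesgue. \<not> (l \<in> {0<..1 / real m} \<longrightarrow> (\<forall>y\<in>K_set m l - {0}. y \<notin> \<rat>))}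
        \<subseteq> N \<union> {1 / real m}"
      by blast
  qed
  show ?thesis
    using N eq meas em ae unfolding N_def by blast
qed

end
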